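(* Let $v$ be a value function satisfying continuity, monotonicity in money-only choices, and non-satiation in money (all defined in the context), and let $$\Delta=\sup_{X,Y,Y'}\big(P_B(X|Y)-P_S(X|Y')\big)$$ be the largest price differential between the buying and the selling price of any bundle. Then we can distinguish between narrow and broad bracketing --- that is, narrow and broad bracketing are identified --- if and only if $\Delta>0$.
   Context: Domain of choice: an agent faces $i\ge 1$ simultaneous choices from choice sets $S_i$. Each $S_i$ has at most $N$ options, for some fixed but finite $N$. Each option $x\in S_i$ is a bounded random amount of $n+1$ goods: the first $n\ge 0$ are consumption goods and the $(n+1)$st good is money. So each option is a bounded random variable over $\mathbb{R}^{n+1}$; the space of these is denoted $\mathbb{X}$, and bundles $X,Y,Y',Z$ below are elements of it. For $m\in\mathbb{R}$, $m$ also denotes the bundle consisting only of the sure amount of money $m$; thus $X-m$ is $X$ with $m$ subtracted from its money coordinate. Sums of choice sets are $S_1+S_2=\{x_1+x_2: x_1\in S_1, x_2\in S_2\}$. Value function: when choosing directly over final outcomes from a set $S$ of possible outcomes, the agent's choices are derived by maximizing a value function $v(x|S)$ over $x\in S$; an option is chosen from $S$ if it maximizes $v(\cdot|S)$ over $S$. Assumptions: (i) Continuity: $v(\cdot|S)$ is continuous in $x$ and $S$; formally, with $S_0=S\setminus\{x\}$, $v(x|S_0\cup\{x\})$ is continuous in $x$ and $S_0$. (ii) Monotonicity in money-only choices: if $S=\{m_1,\dots,m_k\}$ is a choice between sure monetary amounts, then $m_i>m_j\iff v(m_i|S)>v(m_j|S)$. (iii) Non-satiation in money (adding or subtracting sufficiently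 large sums of money from an option makes it eventually the only chosen option, or not chosen): for any $S$ and any $X\in S$, writing $S^{(m)}=(S\setminus\{X\})\cup\{X-m\}$, there is some $m_B$ such that only $X-m$ is chosen from $S^{(m)}$ for all $m<m_B$, and some $m_S$ such that $X-m$ is never chosen from $S^{(m)}$ for any $m>m_S$. Prices: for bundles $X,Y$, a set $S$ not containing $Y$, and $m\in\mathbb{R}$, let $S_m=S\cup\{Y,\,Y+X-m\}$. The buying price of $X$ on top of $Y$ is $$P_B(X|Y)=\sup\{m:\ \exists S \text{ with } \{Y\}\cap S=\varnothing \text{ s.t. } v(Y+X-m|S_m)\ge \max_{Z\in S\cup\{Y\}}v(Z|S_m)\},$$ and the selling price is $$P_S(X|Y)=\inf\{m:\ \exists S \text{ with } \{Y\}\cap S=\varnothing \text{ s.t. } v(Y|S_m)\ge \max_{Z\in S_m}v(Z|S_m)\}.$$ $\Delta$ could be infinite. Bracketing: a person making two simultaneous choices from $S_1$ and $S_2$ brackets narrowly if they maximize $v$ in $S_1$ and $S_2$ separately, choosing $x_i^N\in\arg\max_{x\in S_i}v(x|S_i)$ from each $S_i$ and ending up with $z^N=x_1^N+x_2^N$. They bracket broadly if they maximize $v$ over the combined choice set $S=S_1+S_2$, picking $z^B\in\arg\max_{z\in S}v(z|S)$. Narrow and broad bracketing can be distinguished (are identified) if there are simultaneous choices $S_1,S_2$ in which a narrow and a broad bracketer with value function $v$ choose differently; they cannot be distinguished if a person with value function $v$ always chooses the same way whether bracketing narrowly or broadly.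
   Formalization: Non-satiation is required only for choice sets with at least two options (for a single option it is contradictory), and choice sets may be any finite sets instead of having at most a fixed N options (with a fixed N the equivalence fails). *)

theory Defs
  imports
    "HOL-Probability.Probability_Measure"
    "HOL-Library.Function_Algebras"
    "HOL-Library.Set_Algebras"
begin

text \<open>
  Goods are indexed by an arbitrary finite type \<open>'g\<close> with a distinguished element \<open>\<kappa>\<close> for money;
  the other \<open>n = CARD('g) - 1 \<ge> 0\<close> indices are the consumption goods. A bundle is a random variable,
  as a function and not up to almost sure equality. Sums and differences of bundles are pointwise;
  the sum of two choice sets is the Minkowski sum of \<open>Set_Algebras\<close>, while \<open>S - {X}\<close> is set difference.
\<close>

type_synonym ('w, 'g) goods_bundle = "'w \<Rightarrow> real ^ 'g"

type_synonym ('w, 'g) val = "('w, 'g) goods_bundle \<Rightarrow> ('w, 'g) goods_bundle set \<Rightarrow> real"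

definition bundles :: "'w measure \<Rightarrow> ('w, 'g::finite) goods_bundle set" where
  "bundles M = {X. X \<in> borel_measurable M \<and> bounded (range X)}"

definition sure_money :: "'g::finite \<Rightarrow> real \<Rightarrow> ('w, 'g) goods_bundle" where
  "sure_money \<kappa> m = (\<lambda>\<omega>. axis \<kappa> m)"

definition choice_set :: "'w measure \<Rightarrow> ('w, 'g::finite) goods_bundle set \<Rightarrow> bool" where
  "choice_set M S \<longleftrightarrow> finite S \<and> S \<noteq> {} \<and> S \<subseteq> bundles M"

text \<open>\<open>v x S\<close> stands for \<open>v(x|S)\<close>; only its values for choice sets \<open>S\<close> and \<open>x \<in> S\<close> matter.\<close>

definition chosen :: "('w, 'g::finite) val \<Rightarrow> ('w, 'g) goods_bundle set \<Rightarrow> ('w, 'g) goods_bundle set" where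
  "chosen v S = {x \<in> S. \<forall>y\<in>S. v y S \<le> v x S}"


definition bundle_dist :: "('w, 'g::finite) goods_bundle \<Rightarrow> ('w, 'g) goods_bundle \<Rightarrow> real" where
  "bundle_dist X Y = (SUP \<omega>. dist (X \<omega>) (Y \<omega>))"

text \<open>
  For finite sets, \<open>hausdorff_close d A B\<close> says that their Hausdorff distance is less than \<open>d\<close>;
  the empty set is close only to itself.
\<close>

definition hausdorff_close ::
    "real \<Rightarrow> ('w, 'g::finite) goods_bundle set \<Rightarrow> ('w, 'g) goods_bundle set \<Rightarrow> bool" where
  "hausdorff_close d A B \<longleftrightarrow>
     (\<forall>a\<in>A. \<exists>b\<in>B. bundle_dist a b < d) \<and> (\<forall>b\<in>B. \<exists>a\<in>A. bundle_dist a b < d)"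

text \<open>
  Joint continuity of \<open>(x, S\<^sub>0) \<mapsto> v(x|S\<^sub>0 \<union> {x})\<close> on the pairs with \<open>x \<notin> S\<^sub>0\<close>, for the uniform
  distance on bundles and the Hausdorff distance on sets, separately on the choice sets with at
  most \<open>N\<close> options for each \<open>N\<close>.
\<close>

definition continuous_value :: "'w measure \<Rightarrow> ('w, 'g::finite) val \<Rightarrow> bool" where
  "continuous_value M v \<longleftrightarrow>
     (\<forall>N x S0. choice_set M (insert x S0) \<and> x \<notin> S0 \<and> card (insert x S0) \<le> N \<longrightarrow>
       (\<forall>e>0. \<exists>d>0. \<forall>x' S0'.
          choice_set M (insert x' S0') \<and> x' \<notin> S0' \<and> card (insert x' S0') \<le> N \<and>
          bundle_dist x x' < d \<and> hausdorff_close d S0 S0' \<longrightarrow>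
          \<bar>v x' (insert x' S0') - v x (insert x S0)\<bar> < e))"

definition money_monotone :: "'g::finite \<Rightarrow> ('w, 'g) val \<Rightarrow> bool" where
  "money_monotone \<kappa> v \<longleftrightarrow>
     (\<forall>A. finite A \<longrightarrow> (\<forall>a\<in>A. \<forall>b\<in>A.
        a > b \<longleftrightarrow>
        v (sure_money \<kappa> a) (sure_money \<kappa> ` A) > v (sure_money \<kappa> b) (sure_money \<kappa> ` A)))"

text \<open>
  Singletons \<open>S = {X}\<close> are excluded: the only option of \<open>{X - m}\<close> is chosen for every \<open>m\<close>, so
  including them would make the second clause unsatisfiable.
\<close>

definition money_nonsatiated :: "'w measure \<Rightarrow> 'g::finite \<Rightarrow> ('w, 'g) val \<Rightarrow> bool" where
  "money_nonsatiated M \<kappa> v \<longleftrightarrow>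
     (\<forall>S X. choice_set M S \<and> X \<in> S \<and> S \<noteq> {X} \<longrightarrow>
       (\<exists>mB. \<forall>m<mB. chosen v (insert (X - sure_money \<kappa> m) (S - {X})) = {X - sure_money \<kappa> m}) \<and>
       (\<exists>mS. \<forall>m>mS. X - sure_money \<kappa> m \<notin> chosen v (insert (X - sure_money \<kappa> m) (S - {X}))))"


definition offer_set :: "'g::finite \<Rightarrow> ('w, 'g) goods_bundle \<Rightarrow> ('w, 'g) goods_bundle \<Rightarrow>
    ('w, 'g) goods_bundle set \<Rightarrow> real \<Rightarrow> ('w, 'g) goods_bundle set" where
  "offer_set \<kappa> X Y S m = S \<union> {Y, Y + X - sure_money \<kappa> m}"

text \<open>In both prices the context \<open>S\<close> is finite and may be empty.\<close>

definition buying_price :: "'w measure \<Rightarrow> 'g::finite \<Rightarrow> ('w, 'g) val \<Rightarrow>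
    ('w, 'g) goods_bundle \<Rightarrow> ('w, 'g) goods_bundle \<Rightarrow> ereal" where
  "buying_price M \<kappa> v X Y =
     Sup (ereal ` {m. \<exists>S. finite S \<and> S \<subseteq> bundles M \<and> {Y} \<inter> S = {} \<and>
        v (Y + X - sure_money \<kappa> m) (offer_set \<kappa> X Y S m)
          \<ge> Max ((\<lambda>Z. v Z (offer_set \<kappa> X Y S m)) ` (S \<union> {Y}))})"

definition selling_price :: "'w measure \<Rightarrow> 'g::finite \<Rightarrow> ('w, 'g) val \<Rightarrow>
    ('w, 'g) goods_bundle \<Rightarrow> ('w, 'g) goods_bundle \<Rightarrow> ereal" where
  "selling_price M \<kappa> v X Y =
     Inf (ereal ` {m. \<exists>S. finite S \<and> S \<subseteq> bundles M \<and> {Y} \<inter> S = {} \<and>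
        v Y (offer_set \<kappa> X Y S m)
          \<ge> Max ((\<lambda>Z. v Z (offer_set \<kappa> X Y S m)) ` offer_set \<kappa> X Y S m)})"

text \<open>
  Non-satiation gives \<open>buying_price > -\<infinity>\<close> and \<open>selling_price < \<infinity>\<close>, so the difference below
  is never of the form \<open>\<infinity> - \<infinity>\<close> or \<open>(-\<infinity>) - (-\<infinity>)\<close>.
\<close>

definition price_differential :: "'w measure \<Rightarrow> 'g::finite \<Rightarrow> ('w, 'g) val \<Rightarrow> ereal" where
  "price_differential M \<kappa> v =
     (SUP (X, Y, Y') \<in> bundles M \<times> bundles M \<times> bundles M.
        buying_price M \<kappa> v X Y - selling_price M \<kappa> v X Y')"


definition narrow_outcomes :: "('w, 'g::finite) val \<Rightarrow> ('w, 'g) goods_bundle set \<Rightarrow>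
    ('w, 'g) goods_bundle set \<Rightarrow> ('w, 'g) goods_bundle set" where
  "narrow_outcomes v S1 S2 = {x1 + x2 | x1 x2. x1 \<in> chosen v S1 \<and> x2 \<in> chosen v S2}"

definition broad_outcomes :: "('w, 'g::finite) val \<Rightarrow> ('w, 'g) goods_bundle set \<Rightarrow>
    ('w, 'g) goods_bundle set \<Rightarrow> ('w, 'g) goods_bundle set" where
  "broad_outcomes v S1 S2 = chosen v (S1 + S2)"

definition bracketing_identified :: "'w measure \<Rightarrow> ('w, 'g::finite) val \<Rightarrow> bool" where
  "bracketing_identified M v \<longleftrightarrow>
     (\<exists>S1 S2. choice_set M S1 \<and> choice_set M S2 \<and>
        narrow_outcomes v S1 S2 \<noteq> broad_outcomes v S1 S2)"

end

theory Submission
  imports Defs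
begin

text \<open>
  Call prices consistent if no buying price of \<open>X\<close> exceeds a selling price of \<open>X\<close>, whatever the
  contexts; this is \<open>\<Delta> \<le> 0\<close>. By continuity and non-satiation every \<open>X\<close> has, on top of every \<open>Y\<close>,
  an amount of money at which \<open>Y\<close> and \<open>Y + X - m\<close> are both chosen, so consistency makes this amount
  a function \<open>p X\<close>. Choices are then \<open>p\<close>-maximal, \<open>p\<close> is additive (otherwise some three-element
  set would have no choice), and by continuity every \<open>p\<close>-maximal option is chosen. Maximizers of an
  additive function commute with Minkowski sums.

  Conversely, suppose that \<open>C (S + T) = C S + C T\<close> for all choice sets. Additivity makes \<open>C\<close> depend
  essentially on convex hulls only: extreme points of \<open>C G\<close> cannot be midpoints of other options in
  \<open>G\<close>. Applied to sums of pairs, this gives an additive \<open>p\<close> governing choices from pairs;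
  applied to \<open>K + L\<close> with \<open>C L = {0}\<close>, it shows that everything chosen from any \<open>K\<close> maximizes \<open>p\<close>.
  Evaluating \<open>p\<close> at the options in the definitions of the two prices yields consistency.
\<close>

section \<open>Arithmetic of bundles and sure money, and existence of choices\<close>

lemma bundles_add:
  assumes "X \<in> bundles M" "Y \<in> bundles M"
  shows "X + Y \<in> bundles M"
  using assms bounded_plus_comp[of X UNIV Y]
  by (simp add: bundles_def plus_fun_def borel_measurable_add)

lemma bundles_diff:
  assumes "X \<in> bundles M" "Y \<in> bundles M"
  shows "X - Y \<in> bundles M"
  using assms bounded_minus_comp[of X UNIV Y]
  by (simp add: bundles_def fun_diff_def borel_measurable_diff)

lemma sure_money_in_bundles: "sure_money \<kappa> m \<in> bundles M"
  by (auto simp: bundles_def sure_money_def image_def)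

lemma sure_money_zero [simp]: "sure_money \<kappa> 0 = 0"
  by (auto simp: sure_money_def fun_eq_iff)

lemma sure_money_add: "sure_money \<kappa> (a + b) = sure_money \<kappa> a + sure_money \<kappa> b"
  by (auto simp: sure_money_def fun_eq_iff vec_eq_iff axis_def)

lemma sure_money_diff: "sure_money \<kappa> (a - b) = sure_money \<kappa> a - sure_money \<kappa> b"
  by (auto simp: sure_money_def fun_eq_iff vec_eq_iff axis_def)

lemma sure_money_uminus: "sure_money \<kappa> (- a) = - sure_money \<kappa> a"
  by (auto simp: sure_money_def fun_eq_iff vec_eq_iff axis_def)

lemma sure_money_eq_iff [simp]: "sure_money \<kappa> a = sure_money \<kappa> b \<longleftrightarrow> a = b"
  by (auto simp: sure_money_def fun_eq_iff axis_eq_axis)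

lemma sure_money_eq_0_iff [simp]: "sure_money \<kappa> a = 0 \<longleftrightarrow> a = 0"
  using sure_money_eq_iff[of \<kappa> a 0] by (simp del: sure_money_eq_iff)

lemma zero_in_bundles: "0 \<in> bundles M"
  using sure_money_in_bundles[of undefined 0 M] by simp

lemma bundles_uminus: "X \<in> bundles M \<Longrightarrow> - X \<in> bundles M"
  using bundles_diff[OF zero_in_bundles] by force

lemmas bundles_closed = bundles_add bundles_diff sure_money_in_bundles zero_in_bundles bundles_uminus

lemma choice_set_plus: "choice_set M S \<Longrightarrow> choice_set M T \<Longrightarrow> choice_set M (S + T)"
  unfolding choice_set_def set_plus_def
  by (auto intro!: bundles_add finite_image_set2[of "\<lambda>x. x \<in> S" "\<lambda>x. x \<in> T" "(+)"]) 

lemma chosen_nonempty: "choice_set M S \<Longrightarrow> chosen v S \<noteq> {}"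
proof -
  assume S: "choice_set M S"
  define m where "m = Max ((\<lambda>y. v y S) ` S)"
  have "m \<in> (\<lambda>y. v y S) ` S" unfolding m_def
    using S by (intro Max_in) (auto simp: choice_set_def)
  then obtain x where x: "x \<in> S" "v x S = m" by auto
  have "\<forall>y\<in>S. v y S \<le> m" unfolding m_def using S by (auto simp: choice_set_def)
  with x show ?thesis by (auto simp: chosen_def)
qed

lemma chosen_subset: "chosen v S \<subseteq> S"
  by (auto simp: chosen_def)

lemma choice_set_chosen: "choice_set M S \<Longrightarrow> choice_set M (chosen v S)"
  using chosen_nonempty[of M S v] chosen_subset[of v S]
  by (auto simp: choice_set_def intro: finite_subset)

lemma bundle_dist_self [simp]: "bundle_dist X X = 0"
  by (simp add: bundle_dist_def)

lemma bundle_dist_minus_money [simp]: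
  "bundle_dist (X - sure_money \<kappa> a) (X - sure_money \<kappa> b) = \<bar>a - b\<bar>"
proof -
  have "dist ((X - sure_money \<kappa> a) w) ((X - sure_money \<kappa> b) w) = \<bar>a - b\<bar>" for w
  proof -
    have "axis \<kappa> b - axis \<kappa> a = (axis \<kappa> (b - a) :: real ^ 'b)"
      by (auto simp: vec_eq_iff axis_def)
    moreover have "norm (axis \<kappa> (b - a) :: real ^ 'b) = \<bar>b - a\<bar>"
      by (simp add: norm_eq_sqrt_inner inner_axis_axis)
    ultimately show ?thesis
      by (simp add: dist_norm sure_money_def abs_minus_commute)
  qed
  then show ?thesis by (simp add: bundle_dist_def)
qed

lemma bundle_dist_plus_money [simp]: "bundle_dist X (X + sure_money \<kappa> a) = \<bar>a\<bar>"
  using bundle_dist_minus_money[of X \<kappa> 0 "- a"] by (simp add: sure_money_uminus)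

lemma hausdorff_close_self: "d > 0 \<Longrightarrow> hausdorff_close d S S"
  by (auto simp: hausdorff_close_def intro!: bexI)

subsection \<open>Faces of Minkowski sums\<close>

definition face :: "('a \<Rightarrow> real) \<Rightarrow> 'a set \<Rightarrow> 'a set" where
  "face f S = {x \<in> S. \<forall>y\<in>S. f y \<le> f x}"

lemma face_subset: "face f S \<subseteq> S"
  by (auto simp: face_def)

lemma finite_face: "finite S \<Longrightarrow> finite (face f S)"
  using face_subset by (rule finite_subset)

lemma face_nonempty: "finite S \<Longrightarrow> S \<noteq> {} \<Longrightarrow> face f S \<noteq> {}"
proof -
  assume S: "finite S" "S \<noteq> {}"
  have "Max (f ` S) \<in> f ` S" using S by (intro Max_in) auto
  then obtain x where "x \<in> S" "f x = Max (f ` S)" by auto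
  with S have "x \<in> face f S" by (auto simp: face_def)
  then show ?thesis by auto
qed

text \<open>A sum is maximal exactly when both summands are. Additivity is asked only across
  \<open>A\<close> and \<open>B\<close> because the price functions are shown to be additive on
  bundles only.\<close>

lemma face_plus:
  fixes A B :: "'a::ab_group_add set"
  assumes "finite A" "A \<noteq> {}" "finite B" "B \<noteq> {}"
    and add: "\<And>x y. x \<in> A \<Longrightarrow> y \<in> B \<Longrightarrow> f (x + y) = f x + f y"
  shows "face f (A + B) = face f A + face f B"
proof
  obtain a b where a: "a \<in> face f A" and b: "b \<in> face f B"
    using face_nonempty assms by (metis ex_in_conv)
  show "face f (A + B) \<subseteq> face f A + face f B"
  proof
    fix z assume z: "z \<in> face f (A + B)"
    then obtain x y where xy: "z = x + y" "x \<in> A" "y \<in> B"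
      by (auto simp: face_def elim: set_plus_elim)
    have "f (a + b) \<le> f z"
      using z a b by (auto simp: face_def set_plus_intro)
    then have "f a + f b \<le> f x + f y" using add xy a b by (auto simp: face_def)
    moreover have "f x \<le> f a" "f y \<le> f b" using a b xy by (auto simp: face_def)
    ultimately have "f x = f a" "f y = f b" by auto
    then have "x \<in> face f A" "y \<in> face f B" using a b xy by (auto simp: face_def)
    then show "z \<in> face f A + face f B" using xy by (auto simp: set_plus_intro)
  qed
  show "face f A + face f B \<subseteq> face f (A + B)"
    using add by (auto simp: face_def set_plus_intro add_mono elim!: set_plus_elim)
qed

lemma nonzero_coordinate:
  fixes x :: "('w, 'g::finite) goods_bundle"
  assumes "x \<noteq> 0"
  obtains w i where "x w $ i \<noteq> 0"
  using assms by (auto simp: fun_eq_iff vec_eq_iff)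

text \<open>Both sides have the same convex hull after cancelling \<open>D\<close>, so the extreme points of \<open>D\<close>
  lie in \<open>E\<close>; the extreme point is found by repeatedly passing to a face in a coordinate direction.\<close>

lemma Minkowski_cancel_meets:
  fixes D E :: "('w, 'g::finite) goods_bundle set"
  assumes "finite D" "D \<noteq> {}" "finite E" "E \<noteq> {}" "E + D = D + D"
  shows "E \<inter> D \<noteq> {}"
  using assms
proof (induction "card D" arbitrary: D E rule: less_induct)
  case less
  show ?case
  proof (cases "\<exists>a\<in>D. \<exists>b\<in>D. a \<noteq> b")
    case True
    then obtain a b where ab: "a \<in> D" "b \<in> D" "a - b \<noteq> 0" by auto
    obtain w i where wi: "(a - b) w $ i \<noteq> 0" using nonzero_coordinate[OF ab(3)] .
    define f where "f = (\<lambda>x :: ('w, 'g) goods_bundle. x w $ i)"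
    have f: "f (x + y) = f x + f y" for x y by (simp add: f_def)
    have "f a \<noteq> f b" using wi by (simp add: f_def)
    then have "\<not> (a \<in> face f D \<and> b \<in> face f D)"
      using ab by (auto simp: face_def intro: antisym)
    then have "face f D \<subset> D" using face_subset[of f D] ab by blast
    then have "card (face f D) < card D" using less.prems by (simp add: psubset_card_mono)
    moreover have "face f E + face f D = face f D + face f D"
      using face_plus[OF less.prems(3,4,1,2), of f] face_plus[OF less.prems(1,2,1,2), of f]
        f less.prems(5) by simp
    ultimately have "face f E \<inter> face f D \<noteq> {}"
      by (intro less.hyps finite_face face_nonempty less.prems)
    then show ?thesis using face_subset[of f E] face_subset[of f D] by blast
  next
    case False
    then obtain d where d: "D = {d}" using less.prems(2) by auto
    obtain e where e: "e \<in> E" using less.prems by auto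
    have "e + d \<in> E + D" using d e by (intro set_plus_intro) auto
    then have "e + d = d + d" using d less.prems(5) by (auto elim: set_plus_elim)
    then show ?thesis using e d by auto
  qed
qed

section \<open>Indifference amounts by continuity\<close>

locale value_fun =
  fixes M :: "'w measure" and \<kappa> :: "'g::finite" and v :: "('w, 'g) val"
  assumes cont: "continuous_value M v"
    and mono: "money_monotone \<kappa> v"
    and nonsat: "money_nonsatiated M \<kappa> v"
begin

abbreviation "V \<equiv> (bundles M :: ('w, 'g) goods_bundle set)"
abbreviation "money \<equiv> (sure_money \<kappa> :: real \<Rightarrow> ('w, 'g) goods_bundle)"
abbreviation "C \<equiv> chosen v"

lemma choice_set_singleton: "x \<in> V \<Longrightarrow> choice_set M {x}"
  by (auto simp: choice_set_def)

lemma continuous_valueD: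
  assumes "choice_set M (insert x S0)" "x \<notin> S0" "card (insert x S0) \<le> N" "e > 0"
  obtains d where "d > 0"
    "\<And>x' S0'. choice_set M (insert x' S0') \<Longrightarrow> x' \<notin> S0' \<Longrightarrow> card (insert x' S0') \<le> N \<Longrightarrow>
       bundle_dist x x' < d \<Longrightarrow> hausdorff_close d S0 S0' \<Longrightarrow>
       \<bar>v x' (insert x' S0') - v x (insert x S0)\<bar> < e"
  using cont assms unfolding continuous_value_def by meson

text \<open>Intermediate value theorem for the value difference within the pair as \<open>m\<close>
  varies. The two options can coincide only if \<open>X\<close> is sure money, and then the amount
  at which they do serves.\<close>

lemma ex_indifference_price:
  assumes X: "X \<in> V" and Y: "Y \<in> V"
  shows "\<exists>m. C {Y, Y + X - money m} = {Y, Y + X - money m}"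
proof (cases "\<exists>m. X = money m")
  case True
  then obtain m where "X = money m" by auto
  then have "C {Y, Y + X - money m} = {Y, Y + X - money m}" by (auto simp: chosen_def)
  then show ?thesis by blast
next
  case False
  define Z where "Z = Y + X"
  have Z: "Z \<in> V" using X Y by (simp add: Z_def bundles_closed)
  have ne: "Z - money m \<noteq> Y" "Y \<noteq> Z - money m" for m
    using False by (auto simp: Z_def algebra_simps)
  then have ne0: "Z \<noteq> Y" "Y \<noteq> Z" using sure_money_zero[of \<kappa>] by (metis diff_zero)+
  have cs: "choice_set M {Z - money m, Y}" for m
    using Z Y by (auto simp: choice_set_def bundles_closed)
  define f where "f = (\<lambda>m. v (Z - money m) {Z - money m, Y} - v Y {Z - money m, Y})"
  have contf: "isCont f m" for m
  proof -
    have 1: "isCont (\<lambda>m. v (Z - money m) {Z - money m, Y}) m"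
      unfolding continuous_at_eps_delta
    proof (intro allI impI)
      fix e :: real assume "e > 0"
      then obtain d where d: "d > 0" "\<And>x' S0'. choice_set M (insert x' S0') \<Longrightarrow> x' \<notin> S0' \<Longrightarrow>
          card (insert x' S0') \<le> 2 \<Longrightarrow> bundle_dist (Z - money m) x' < d \<Longrightarrow>
          hausdorff_close d {Y} S0' \<Longrightarrow>
          \<bar>v x' (insert x' S0') - v (Z - money m) {Z - money m, Y}\<bar> < e"
        using continuous_valueD[of "Z - money m" "{Y}" 2 e] cs ne by (auto simp: card_insert_if)
      show "\<exists>d>0. \<forall>m'. dist m' m < d \<longrightarrow>
          dist (v (Z - money m') {Z - money m', Y}) (v (Z - money m) {Z - money m, Y}) < e"
        using d cs ne
        by (intro exI[of _ d])
          (auto simp: dist_real_def card_insert_if hausdorff_close_def abs_minus_commute)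
    qed
    \<comment> \<open>The same pair split the other way: \<open>Y\<close> is now the distinguished
      option and the moving bundle forms the context.\<close>
    have 2: "isCont (\<lambda>m. v Y {Z - money m, Y}) m"
      unfolding continuous_at_eps_delta
    proof (intro allI impI)
      fix e :: real assume "e > 0"
      then obtain d where d: "d > 0" "\<And>x' S0'. choice_set M (insert x' S0') \<Longrightarrow> x' \<notin> S0' \<Longrightarrow>
          card (insert x' S0') \<le> 2 \<Longrightarrow> bundle_dist Y x' < d \<Longrightarrow>
          hausdorff_close d {Z - money m} S0' \<Longrightarrow>
          \<bar>v x' (insert x' S0') - v Y {Y, Z - money m}\<bar> < e"
        using continuous_valueD[of Y "{Z - money m}" 2 e] cs[of m] ne
        by (auto simp: card_insert_if insert_commute)
      show "\<exists>d>0. \<forall>m'. dist m' m < d \<longrightarrow>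
          dist (v Y {Z - money m', Y}) (v Y {Z - money m, Y}) < e"
      proof (intro exI[of _ d] conjI allI impI d(1))
        fix m' assume "dist m' m < d"
        then show "dist (v Y {Z - money m', Y}) (v Y {Z - money m, Y}) < e"
          using d(1) d(2)[of Y "{Z - money m'}"] cs[of m'] ne
          by (auto simp: dist_real_def card_insert_if hausdorff_close_def abs_minus_commute
              insert_commute)
      qed
    qed
    show ?thesis unfolding f_def by (intro continuous_intros 1 2)
  qed
  have S: "choice_set M {Z, Y}" "Z \<in> {Z, Y}" "{Z, Y} \<noteq> {Z}" "{Z, Y} - {Z} = {Y}"
    using cs[of 0] ne0 by auto
  obtain mB mS where mB: "\<And>m. m < mB \<Longrightarrow> C {Z - money m, Y} = {Z - money m}"
    and mS: "\<And>m. m > mS \<Longrightarrow> Z - money m \<notin> C {Z - money m, Y}"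
    using nonsat S unfolding money_nonsatiated_def by metis
  \<comment> \<open>Far enough out, non-satiation fixes the sign of \<open>f\<close> at both ends;
    \<open>min\<close> and \<open>max\<close> ensure \<open>a \<le> b\<close>.\<close>
  define a b where "a = min mB mS - 1" and "b = max mB mS + 1"
  have "a \<le> b" by (auto simp: a_def b_def)
  have "a < mB" "b > mS" by (auto simp: a_def b_def)
  then have "Z - money a \<in> C {Z - money a, Y}" "Z - money b \<notin> C {Z - money b, Y}"
    using mB[of a] mS[of b] by auto
  then have "f a \<ge> 0" "f b \<le> 0" by (auto simp: f_def chosen_def)
  moreover have "continuous_on {a..b} f"
    using contf by (intro continuous_at_imp_continuous_on) blast
  ultimately obtain m where "f m = 0"
    using IVT2'[of f b 0 a] \<open>a \<le> b\<close> by blast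
  then have "C {Z - money m, Y} = {Z - money m, Y}" by (auto simp: f_def chosen_def)
  then have "C {Y, Y + X - money m} = {Y, Y + X - money m}"
    by (simp add: Z_def insert_commute)
  then show ?thesis by blast
qed

subsection \<open>Prices\<close>

text \<open>Phrased through witnessing choice sets, which keeps extended reals out of both main
  implications; \<open>S\<close> and \<open>S'\<close> already contain the offers.\<close>

definition consistent_prices :: bool where
  "consistent_prices \<longleftrightarrow>
     (\<forall>X\<in>V. \<forall>Y\<in>V. \<forall>Y'\<in>V. \<forall>m m' S S'. choice_set M S \<longrightarrow> choice_set M S' \<longrightarrow>
        Y \<in> S \<longrightarrow> Y + X - money m \<in> C S \<longrightarrow> Y' \<in> C S' \<longrightarrow> Y' + X - money m' \<in> S' \<longrightarrow> m \<le> m')"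

definition buying_amounts where
  "buying_amounts X Y = {m. \<exists>S. choice_set M S \<and> Y \<in> S \<and> Y + X - money m \<in> C S}"

definition selling_amounts where
  "selling_amounts X Y = {m. \<exists>S. choice_set M S \<and> Y \<in> C S \<and> Y + X - money m \<in> S}"

text \<open>Adding both options to a context gives a choice set; deleting \<open>Y\<close> from a
  choice set gives a context, and \<open>offer_set\<close> restores what was deleted.\<close>

lemma buying_price_eq:
  assumes "X \<in> V" "Y \<in> V"
  shows "buying_price M \<kappa> v X Y = Sup (ereal ` buying_amounts X Y)"
proof -
  have "(\<exists>S. finite S \<and> S \<subseteq> V \<and> {Y} \<inter> S = {} \<and>
        v (Y + X - money m) (offer_set \<kappa> X Y S m)
          \<ge> Max ((\<lambda>Z. v Z (offer_set \<kappa> X Y S m)) ` (S \<union> {Y}))) \<longleftrightarrow> m \<in> buying_amounts X Y"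
    (is "?L \<longleftrightarrow> _") for m
  proof
    assume ?L
    then obtain S where S: "finite S" "S \<subseteq> V"
      "v (Y + X - money m) (offer_set \<kappa> X Y S m)
          \<ge> Max ((\<lambda>Z. v Z (offer_set \<kappa> X Y S m)) ` (S \<union> {Y}))" by blast
    have "choice_set M (offer_set \<kappa> X Y S m)"
      using S assms by (auto simp: choice_set_def offer_set_def bundles_closed)
    moreover have "Y + X - money m \<in> C (offer_set \<kappa> X Y S m)"
      using S by (auto simp: chosen_def offer_set_def)
    ultimately show "m \<in> buying_amounts X Y"
      unfolding buying_amounts_def by (auto simp: offer_set_def)
  next
    assume "m \<in> buying_amounts X Y"
    then obtain S where S: "choice_set M S" "Y \<in> S" "Y + X - money m \<in> C S"
      unfolding buying_amounts_def by auto
    have "offer_set \<kappa> X Y (S - {Y}) m = S"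
      using S by (auto simp: offer_set_def chosen_def)
    then show ?L
      using S by (intro exI[of _ "S - {Y}"]) (auto simp: choice_set_def chosen_def)
  qed
  then show ?thesis unfolding buying_price_def by simp
qed

lemma selling_price_eq:
  assumes "X \<in> V" "Y \<in> V"
  shows "selling_price M \<kappa> v X Y = Inf (ereal ` selling_amounts X Y)"
proof -
  have "(\<exists>S. finite S \<and> S \<subseteq> V \<and> {Y} \<inter> S = {} \<and>
        v Y (offer_set \<kappa> X Y S m)
          \<ge> Max ((\<lambda>Z. v Z (offer_set \<kappa> X Y S m)) ` offer_set \<kappa> X Y S m))
        \<longleftrightarrow> m \<in> selling_amounts X Y" (is "?L \<longleftrightarrow> _") for m
  proof
    assume ?L
    then obtain S where S: "finite S" "S \<subseteq> V"
      "v Y (offer_set \<kappa> X Y S m)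
          \<ge> Max ((\<lambda>Z. v Z (offer_set \<kappa> X Y S m)) ` offer_set \<kappa> X Y S m)" by blast
    have cs: "choice_set M (offer_set \<kappa> X Y S m)"
      using S assms by (auto simp: choice_set_def offer_set_def bundles_closed)
    then have "Y \<in> C (offer_set \<kappa> X Y S m)"
      using S(3) by (auto simp: chosen_def choice_set_def) (auto simp: offer_set_def)
    with cs show "m \<in> selling_amounts X Y"
      unfolding selling_amounts_def by (auto simp: offer_set_def)
  next
    assume "m \<in> selling_amounts X Y"
    then obtain S where S: "choice_set M S" "Y \<in> C S" "Y + X - money m \<in> S"
      unfolding selling_amounts_def by auto
    have "offer_set \<kappa> X Y (S - {Y}) m = S"
      using S by (auto simp: offer_set_def chosen_def)
    then show ?L
      using S by (intro exI[of _ "S - {Y}"]) (auto simp: choice_set_def chosen_def)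
  qed
  then show ?thesis unfolding selling_price_def by simp
qed

text \<open>The indifferent pair witnesses both memberships. In particular neither set is
  empty.\<close>

lemma amounts_meet:
  assumes "X \<in> V" "Y \<in> V"
  shows "\<exists>m. m \<in> buying_amounts X Y \<and> m \<in> selling_amounts X Y"
proof -
  obtain m where m: "C {Y, Y + X - money m} = {Y, Y + X - money m}"
    using ex_indifference_price[OF assms] by auto
  moreover have "choice_set M {Y, Y + X - money m}"
    using assms by (auto simp: choice_set_def bundles_closed)
  ultimately show ?thesis
    unfolding buying_amounts_def selling_amounts_def by blast
qed

lemma consistent_prices_alt:
  "consistent_prices \<longleftrightarrow> (\<forall>X\<in>V. \<forall>Y\<in>V. \<forall>Y'\<in>V. \<forall>a\<in>buying_amounts X Y. \<forall>b\<in>selling_amounts X Y'. a \<le> b)"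
  unfolding consistent_prices_def buying_amounts_def selling_amounts_def by blast

lemma price_differential_le_0_iff: "price_differential M \<kappa> v \<le> 0 \<longleftrightarrow> consistent_prices"
proof -
  have "buying_price M \<kappa> v X Y - selling_price M \<kappa> v X Y' \<le> 0 \<longleftrightarrow>
      (\<forall>a\<in>buying_amounts X Y. \<forall>b\<in>selling_amounts X Y'. a \<le> b)"
    if XY: "X \<in> V" "Y \<in> V" "Y' \<in> V" for X Y Y'
  proof
    assume le: "buying_price M \<kappa> v X Y - selling_price M \<kappa> v X Y' \<le> 0"
    show "\<forall>a\<in>buying_amounts X Y. \<forall>b\<in>selling_amounts X Y'. a \<le> b"
    proof (intro ballI)
      fix a b assume ab: "a \<in> buying_amounts X Y" "b \<in> selling_amounts X Y'"
      have "ereal a \<le> buying_price M \<kappa> v X Y"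
        using ab XY by (auto simp: buying_price_eq intro: Sup_upper)
      moreover have "selling_price M \<kappa> v X Y' \<le> ereal b"
        using ab XY by (auto simp: selling_price_eq intro: Inf_lower)
      ultimately have "ereal a \<le> ereal b" using le
        by (cases "buying_price M \<kappa> v X Y"; cases "selling_price M \<kappa> v X Y'") auto
      then show "a \<le> b" by simp
    qed
  next
    assume *: "\<forall>a\<in>buying_amounts X Y. \<forall>b\<in>selling_amounts X Y'. a \<le> b"
    \<comment> \<open>\<open>a\<close> bounds the buying price below and \<open>b\<close> the
      selling price above; once the former price is at most the latter, both are finite and can be
      subtracted.\<close>
    obtain a where a: "a \<in> buying_amounts X Y" using amounts_meet XY by blast
    obtain b where b: "b \<in> selling_amounts X Y'" using amounts_meet XY by blast
    have "buying_price M \<kappa> v X Y \<le> selling_price M \<kappa> v X Y'"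
      using * XY by (auto simp: buying_price_eq selling_price_eq intro!: Sup_least Inf_greatest)
    moreover have "ereal a \<le> buying_price M \<kappa> v X Y"
      using a XY by (auto simp: buying_price_eq intro: Sup_upper)
    moreover have "selling_price M \<kappa> v X Y' \<le> ereal b"
      using b XY by (auto simp: selling_price_eq intro: Inf_lower)
    ultimately show "buying_price M \<kappa> v X Y - selling_price M \<kappa> v X Y' \<le> 0"
      by (cases "buying_price M \<kappa> v X Y"; cases "selling_price M \<kappa> v X Y'") auto
  qed
  then show ?thesis
    unfolding price_differential_def consistent_prices_alt
    by (auto simp: SUP_le_iff)
qed

subsection \<open>Consistent prices imply additive choices\<close>

text \<open>If some \<open>W\<close> beat \<open>Y\<close> by \<open>g > 0\<close>, a small enough
  bonus would move each of the two values by less than \<open>g / 2\<close>, so \<open>W\<close>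
  would still beat \<open>Y + money e\<close>.\<close>

lemma chosen_if_chosen_with_bonus:
  assumes A: "choice_set M A" "Y \<in> A"
    and bonus: "\<And>e. e > 0 \<Longrightarrow> Y + money e \<notin> A \<Longrightarrow>
      Y + money e \<in> C (insert (Y + money e) (A - {Y}))"
  shows "Y \<in> C A"
proof (rule ccontr)
  assume nY: "Y \<notin> C A"
  obtain W where W: "W \<in> C A" using chosen_nonempty[OF A(1)] by blast
  then have WA: "W \<in> A" using chosen_subset by blast
  define g where "g = v W A - v Y A"
  have g: "g > 0" using W nY A(2) unfolding chosen_def g_def by fastforce
  have "W \<noteq> Y" using W nY by auto
  have insY: "insert Y (A - {Y}) = A" and insW: "insert W (A - {W}) = A" using A WA by auto
  have half: "g / 2 > 0" and nin: "Y \<notin> A - {Y}" "W \<notin> A - {W}" using g by auto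
  have AV: "finite A" "A \<subseteq> V" using A by (auto simp: choice_set_def)
  obtain d1 where d1: "d1 > 0"
    "\<And>x' S0'. choice_set M (insert x' S0') \<Longrightarrow> x' \<notin> S0' \<Longrightarrow> card (insert x' S0') \<le> card A \<Longrightarrow>
       bundle_dist Y x' < d1 \<Longrightarrow> hausdorff_close d1 (A - {Y}) S0' \<Longrightarrow>
       \<bar>v x' (insert x' S0') - v Y A\<bar> < g / 2"
    using continuous_valueD[of Y "A - {Y}" "card A" "g / 2", unfolded insY, OF A(1) nin(1) order_refl half]
    by blast
  obtain d2 where d2: "d2 > 0"
    "\<And>x' S0'. choice_set M (insert x' S0') \<Longrightarrow> x' \<notin> S0' \<Longrightarrow> card (insert x' S0') \<le> card A \<Longrightarrow>
       bundle_dist W x' < d2 \<Longrightarrow> hausdorff_close d2 (A - {W}) S0' \<Longrightarrow>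
       \<bar>v x' (insert x' S0') - v W A\<bar> < g / 2"
    using continuous_valueD[of W "A - {W}" "card A" "g / 2", unfolded insW, OF A(1) nin(2) order_refl half]
    by blast
  \<comment> \<open>Only finitely many bonuses hit another option of \<open>A\<close>; avoiding them
    keeps the improved option distinct from the rest.\<close>
  have "inj (\<lambda>e. Y + money e)" by (auto simp: inj_def)
  then have "finite ((\<lambda>e. Y + money e) -` A)" using AV by (intro finite_vimageI)
  moreover have "infinite {0<..<min d1 d2}" using d1 d2 by (intro infinite_Ioo) auto
  ultimately obtain e where "e \<in> {0<..<min d1 d2} - (\<lambda>e. Y + money e) -` A"
    by (metis all_not_in_conv finite.emptyI Diff_infinite_finite)
  then have e: "0 < e" "e < d1" "e < d2" "Y + money e \<notin> A" by auto
  define A' where "A' = insert (Y + money e) (A - {Y})"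
  have cs: "choice_set M A'" using AV A by (auto simp: A'_def choice_set_def bundles_closed)
  have card: "card A' \<le> card A" using AV card.remove[OF AV(1) A(2)] by (simp add: A'_def card_insert_if)
  have "\<bar>v (Y + money e) A' - v Y A\<bar> < g / 2"
    using d1(2)[of "Y + money e" "A - {Y}"] cs card e d1(1)
      hausdorff_close_self[OF d1(1)] unfolding A'_def by auto
  moreover have "\<bar>v W A' - v W A\<bar> < g / 2"
  proof -
    have A'W: "A' = insert W (A' - {W})" using WA \<open>W \<noteq> Y\<close> by (auto simp: A'_def)
    have "hausdorff_close d2 (A - {W}) (A' - {W})"
      unfolding hausdorff_close_def
    proof (intro conjI ballI)
      fix a assume a: "a \<in> A - {W}"
      show "\<exists>b\<in>A' - {W}. bundle_dist a b < d2"
      proof (cases "a = Y")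
        case True
        then show ?thesis using e WA by (intro bexI[of _ "Y + money e"]) (auto simp: A'_def)
      next
        case False
        then show ?thesis using a d2(1) by (intro bexI[of _ a]) (auto simp: A'_def)
      qed
    next
      fix b assume b: "b \<in> A' - {W}"
      show "\<exists>a\<in>A - {W}. bundle_dist a b < d2"
      proof (cases "b = Y + money e")
        case True
        then show ?thesis using e A \<open>W \<noteq> Y\<close> by (intro bexI[of _ Y]) auto
      next
        case False
        then show ?thesis using b d2(1) by (intro bexI[of _ b]) (auto simp: A'_def)
      qed
    qed
    then show ?thesis using d2(2)[of W "A' - {W}"] A'W cs card d2(1) by auto
  qed
  moreover have "v W A' \<le> v (Y + money e) A'"
    using bonus[OF e(1,4)] WA \<open>W \<noteq> Y\<close> by (auto simp: chosen_def A'_def)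
  ultimately show False using g by (auto simp: g_def abs_if split: if_splits)
qed

lemma not_identified_iff:
  "\<not> bracketing_identified M v \<longleftrightarrow>
     (\<forall>S T. choice_set M S \<longrightarrow> choice_set M T \<longrightarrow> C (S + T) = C S + C T)"
proof -
  have "narrow_outcomes v S T = C S + C T" for S T
    by (auto simp: narrow_outcomes_def set_plus_def)
  then show ?thesis
    unfolding bracketing_identified_def broad_outcomes_def by metis
qed

lemma not_identified_if_consistent_prices:
  assumes cons: consistent_prices
  shows "\<not> bracketing_identified M v"
proof -
  note bundles_closed [simp]
  have cons': "m \<le> m'" if "X \<in> V" "Y \<in> V" "Y' \<in> V" "choice_set M S" "choice_set M S'"
    "Y \<in> S" "Y + X - money m \<in> C S" "Y' \<in> C S'" "Y' + X - money m' \<in> S'" for X Y Y' m m' S S'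
    using cons that unfolding consistent_prices_def by blast
  define p where "p = (\<lambda>X. SOME m. C {0, X - money m} = {0, X - money m})"
  have p: "C {0, X - money (p X)} = {0, X - money (p X)}" if "X \<in> V" for X
    using someI_ex[OF ex_indifference_price[OF that zero_in_bundles, simplified]] by (simp add: p_def)
  have cs: "choice_set M {0, X - money m}" if "X \<in> V" for X m
    using that by (auto simp: choice_set_def)
  \<comment> \<open>At \<open>W\<close>, the option \<open>Z\<close> is \<open>Z - W\<close> offered
    at price \<open>0\<close> and not bought; the tie at \<open>0\<close> buys the same bundle at
    \<open>p (Z - W)\<close>.\<close>
  have upper: "p (Z - W) \<le> 0" if "choice_set M A" "W \<in> C A" "Z \<in> A" for A Z W
  proof -
    have WZ: "W \<in> V" "Z \<in> V" using that chosen_subset[of v A] by (auto simp: choice_set_def)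
    show ?thesis
      using cons'[of "Z - W" 0 W "{0, Z - W - money (p (Z - W))}" A "p (Z - W)" 0]
        p[of "Z - W"] cs that WZ by auto
  qed
  \<comment> \<open>Mirror image: on top of \<open>Z\<close>, the bundle \<open>W - Z\<close> is
    bought at price \<open>0\<close>, while the tie at \<open>0\<close> sells it at
    \<open>p (W - Z)\<close>.\<close>
  have lower: "0 \<le> p (W - Z)" if "choice_set M A" "W \<in> C A" "Z \<in> A" for A Z W
  proof -
    have WZ: "W \<in> V" "Z \<in> V" using that chosen_subset[of v A] by (auto simp: choice_set_def)
    show ?thesis
      using cons'[of "W - Z" Z 0 A "{0, W - Z - money (p (W - Z))}" 0 "p (W - Z)"]
        p[of "W - Z"] cs that WZ by auto
  qed
  \<comment> \<open>Consistency, used in both directions between a tie at \<open>0\<close> and a tie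
    at \<open>Y\<close>, makes the indifference amount independent of \<open>Y\<close>.\<close>
  have p_eqI: "p X = m" if "X \<in> V" "Y \<in> V" "C {Y, Y + X - money m} = {Y, Y + X - money m}" for X Y m
  proof (rule antisym)
    have "choice_set M {Y, Y + X - money m}" using that by (auto simp: choice_set_def)
    then show "p X \<le> m" "m \<le> p X"
      using cons'[of X 0 Y "{0, X - money (p X)}" "{Y, Y + X - money m}" "p X" m]
        cons'[of X Y 0 "{Y, Y + X - money m}" "{0, X - money (p X)}" m "p X"]
        p[of X] cs that by auto
  qed
  have p_shift: "p (X - money c) = p X - c" if "X \<in> V" for X c
    using p_eqI[of "X - money c" 0 "p X - c"] p[OF that] that
    by (simp add: sure_money_diff)
  \<comment> \<open>The pair that defines \<open>p X\<close>, read from its other option, is a tie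
    for \<open>- X\<close>.\<close>
  have p_uminus: "p (- X) = - p X" if "X \<in> V" for X
    using p_eqI[of "- X" "X - money (p X)" "- p X"] p[OF that] that
    by (simp add: sure_money_uminus insert_commute)
  have subadd: "p (X + Y) \<le> p X + p Y" if "X \<in> V" "Y \<in> V" for X Y
  proof (rule ccontr)
    assume "\<not> ?thesis"
    \<comment> \<open>A third of the excess is spread over a cycle: \<open>0\<close> rules out
      \<open>X1\<close>, \<open>X1\<close> rules out \<open>X2\<close>, and \<open>X2\<close> rules
      out \<open>0\<close>, so nothing is left to choose from the three.\<close>
    moreover define q where "q = (p (X + Y) - p X - p Y) / 3"
    ultimately have q: "q > 0" by simp
    define X1 where "X1 = X - money (p X + q)"
    define X2 where "X2 = X + Y - money (p X + p Y + 2 * q)"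
    have V: "X1 \<in> V" "X2 \<in> V" using that by (auto simp: X1_def X2_def)
    have pX1: "p X1 = - q" and pX2: "p X2 = q"
      using that by (auto simp: X1_def X2_def p_shift q_def field_simps)
    have "X2 - X1 = Y - money (p Y + q)"
      by (simp add: X1_def X2_def sure_money_add sure_money_diff algebra_simps flip: sure_money_add)
    then have p21: "p (X2 - X1) = - q" using that by (simp add: p_shift)
    have A: "choice_set M {0, X1, X2}" using V by (auto simp: choice_set_def)
    obtain W where W: "W \<in> C {0, X1, X2}" using chosen_nonempty[OF A] by auto
    then have "W \<in> {0, X1, X2}" using chosen_subset by blast
    then show False
      using upper[OF A W, of X2] lower[OF A W, of 0] lower[OF A W, of X1] pX1 pX2 p21 q by auto
  qed
  have add: "p (X + Y) = p X + p Y" if "X \<in> V" "Y \<in> V" for X Y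
    using subadd[OF that] subadd[of "- X" "- Y"] p_uminus[of X] p_uminus[of Y] p_uminus[of "X + Y"] that
    by simp
  have diff: "p (X - Y) = p X - p Y" if "X \<in> V" "Y \<in> V" for X Y
    using add[of X "- Y"] p_uminus[of Y] that by simp
  have sub: "C A \<subseteq> face p A" if A: "choice_set M A" for A
  proof
    fix W assume W: "W \<in> C A"
    then have WA: "W \<in> A" using chosen_subset by blast
    have "p Z \<le> p W" if "Z \<in> A" for Z
      using upper[OF A W that] diff[of Z W] WA that A by (auto simp: choice_set_def subset_eq)
    then show "W \<in> face p A" using WA by (auto simp: face_def)
  qed
  have C_eq: "C A = face p A" if A: "choice_set M A" for A
  proof
    show "face p A \<subseteq> C A"
    proof
      fix Y assume Y: "Y \<in> face p A"
      then have YA: "Y \<in> A" "Y \<in> V" using A by (auto simp: face_def choice_set_def)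
      show "Y \<in> C A"
      proof (rule chosen_if_chosen_with_bonus[OF A YA(1)])
        fix e :: real assume e: "e > 0"
        let ?A = "insert (Y + money e) (A - {Y})"
        have A': "choice_set M ?A" using A YA by (auto simp: choice_set_def)
        have "p (Y + money e) = p Y + e"
          using p_shift[of Y "- e"] YA by (simp add: sure_money_uminus)
        \<comment> \<open>The bonus breaks all ties, so the inclusion \<open>sub\<close> and
          nonemptiness already determine the choice.\<close>
        then have "face p ?A \<subseteq> {Y + money e}" using Y e by (force simp: face_def)
        then show "Y + money e \<in> C ?A" using sub[OF A'] chosen_nonempty[OF A'] by blast
      qed
    qed
  qed (use sub A in blast)
  have "C (S + T) = C S + C T" if "choice_set M S" "choice_set M T" for S T
    using face_plus[of S T p] that add C_eq choice_set_plus[OF that]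
    by (auto simp: choice_set_def subset_eq)
  then show ?thesis by (simp add: not_identified_iff)
qed

end

subsection \<open>Additive choices imply consistent prices\<close>

locale additive_choice = value_fun M \<kappa> v
  for M :: "'w measure" and \<kappa> :: "'g::finite" and v :: "('w, 'g) val" +
  assumes C_plus: "choice_set M S \<Longrightarrow> choice_set M T \<Longrightarrow> C (S + T) = C S + C T"
begin

text \<open>By the last hypothesis \<open>G + G\<close> is unchanged when one of the two summands loses \<open>R\<close>; additivity of \<open>C\<close> then contradicts \<open>Minkowski_cancel_meets\<close>.\<close>

lemma chosen_face_not_redundant:
  assumes G: "choice_set M G"
    and add: "\<And>x y. x \<in> V \<Longrightarrow> y \<in> V \<Longrightarrow> f (x + y) = f x + f y"
    and R: "R = face f (C G)"
    and red: "\<And>r s. r \<in> R \<Longrightarrow> s \<in> R \<Longrightarrow> \<exists>a\<in>G - R. \<exists>b\<in>G - R. r + s = a + b"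
  shows False
proof -
  have CG: "choice_set M (C G)" using choice_set_chosen[OF G] .
  then have "R \<noteq> {}" unfolding R by (intro face_nonempty) (auto simp: choice_set_def)
  then obtain r where "r \<in> R" by blast
  then have "G - R \<noteq> {}" using red[of r r] by blast
  then have H: "choice_set M (G - R)" using G by (auto simp: choice_set_def)
  have "G + G \<subseteq> (G - R) + G"
  proof
    fix z assume "z \<in> G + G"
    then obtain x y where z: "z = x + y" "x \<in> G" "y \<in> G" by (auto elim: set_plus_elim)
    consider "x \<notin> R" | "y \<notin> R" | "x \<in> R" "y \<in> R" by blast
    then show "z \<in> (G - R) + G"
    proof cases
      case 1
      then show ?thesis using z by (auto intro: set_plus_intro)
    next
      case 2
      then have "y + x \<in> (G - R) + G" using z by (intro set_plus_intro) auto
      then show ?thesis using z by (simp add: add.commute)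
    next
      case 3
      then show ?thesis using red[of x y] z by (auto intro: set_plus_intro)
    qed
  qed
  moreover have "(G - R) + G \<subseteq> G + G" by (rule set_plus_mono2) auto
  ultimately have "C (G - R) + C G = C G + C G"
    using C_plus[OF H G] C_plus[OF G G] by (metis subset_antisym)
  then have eq: "face f (C (G - R) + C G) = face f (C G + C G)" by simp
  have CH: "choice_set M (C (G - R))" using choice_set_chosen[OF H] .
  have CGD: "finite (C G)" "C G \<noteq> {}" "C G \<subseteq> V" and CHD: "finite (C (G - R))" "C (G - R) \<noteq> {}" "C (G - R) \<subseteq> V"
    using CG CH unfolding choice_set_def by simp_all
  have "face f (C (G - R) + C G) = face f (C (G - R)) + face f (C G)"
    by (rule face_plus[OF CHD(1,2) CGD(1,2)], rule add; erule subsetD[rotated], rule CHD CGD)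
  moreover have "face f (C G + C G) = face f (C G) + face f (C G)"
    by (rule face_plus[OF CGD(1,2) CGD(1,2)], rule add; erule subsetD[rotated], rule CGD)
  ultimately have "face f (C (G - R)) + R = R + R"
    using eq by (simp only: R[symmetric])
  moreover have "finite R" unfolding R using CGD(1) by (rule finite_face)
  moreover have "finite (face f (C (G - R)))" using CHD(1) by (rule finite_face)
  moreover have "face f (C (G - R)) \<noteq> {}" using CHD(1,2) by (rule face_nonempty)
  \<comment> \<open>Cancelling \<open>R\<close> finds an element of \<open>R\<close> among the
    options of \<open>G - R\<close>.\<close>
  ultimately have "face f (C (G - R)) \<inter> R \<noteq> {}"
    using \<open>R \<noteq> {}\<close> Minkowski_cancel_meets[of R "face f (C (G - R))"] by blast
  moreover have "face f (C (G - R)) \<subseteq> G - R"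
    using face_subset chosen_subset by (rule subset_trans)
  ultimately show False by blast
qed

text \<open>The case \<open>R = {0}\<close>, where the redundancy is
  \<open>0 + 0 = a + - a\<close>.\<close>

lemma chosen_zero_not_midpoint:
  assumes "choice_set M G" "\<And>x y. f (x + y) = f x + f y" "{0} = face f (C G)"
    and a: "a \<in> G" "- a \<in> G" "a \<noteq> 0"
  shows False
proof (rule chosen_face_not_redundant[where G = G and f = f and R = "{0}"])
  show "choice_set M G" "{0} = face f (C G)" by fact+
  show "f (x + y) = f x + f y" for x y by (rule assms)
  fix r s :: "('w, 'g) goods_bundle" assume "r \<in> {0}" "s \<in> {0}"
  then have "r + s = a + - a" by simp
  moreover have "a \<in> G - {0}" "- a \<in> G - {0}" using a by simp_all
  ultimately show "\<exists>a\<in>G - {0}. \<exists>b\<in>G - {0}. r + s = a + b"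
    by - (rule bexI, rule bexI, assumption+)
qed

lemma C_plus3:
  assumes "choice_set M A" "choice_set M B" "choice_set M D"
  shows "C (A + (B + D)) = C A + (C B + C D)"
  unfolding C_plus[OF assms(1) choice_set_plus[OF assms(2,3)]] C_plus[OF assms(2,3)] ..

section \<open>Choices from pairs containing the zero bundle\<close>

text \<open>Strict preference over \<open>0\<close>. The clause \<open>y \<noteq> 0\<close> makes
  the zero bundle a tie only, so that \<open>pos\<close> and \<open>tie\<close> exclude each
  other.\<close>

definition pos where "pos y \<longleftrightarrow> y \<noteq> 0 \<and> C {0, y} = {y}"
definition tie where "tie y \<longleftrightarrow> C {0, y} = {0, y}"

lemma choice_set_pair: "y \<in> V \<Longrightarrow> choice_set M {0, y}"
  by (auto simp: choice_set_def bundles_closed)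

lemma C_singleton: "C {x} = {x}"
  by (auto simp: chosen_def)

text \<open>Adding a singleton is a translation, so choices commute with translations.\<close>

lemma C_uminus: "y \<in> V \<Longrightarrow> C {0, - y} = {- y} + C {0, y}"
proof -
  assume y: "y \<in> V"
  have "{0, - y} = {- y} + {0, y}" by (auto simp: set_plus_def)
  then show ?thesis
    using C_plus[of "{- y}" "{0, y}"] y choice_set_pair C_singleton choice_set_singleton
    by (metis bundles_uminus)
qed

lemma C_pair_cases: "y \<in> V \<Longrightarrow> C {0, y} = {0} \<or> C {0, y} = {y} \<or> C {0, y} = {0, y}"
  using chosen_nonempty[OF choice_set_pair, of y v] chosen_subset[of v "{0, y}"] by blast

lemma C_uminus_if_pos: "y \<in> V \<Longrightarrow> pos y \<Longrightarrow> C {0, - y} = {0}"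
  by (simp add: C_uminus pos_def set_plus_def)

lemma tie_uminus: "y \<in> V \<Longrightarrow> tie y \<Longrightarrow> tie (- y)"
  by (auto simp: C_uminus tie_def set_plus_def)

lemma pos_not_tie: "pos y \<Longrightarrow> \<not> tie y"
  by (auto simp: pos_def tie_def)

lemma pos_asym: "y \<in> V \<Longrightarrow> pos y \<Longrightarrow> \<not> pos (- y)"
  using C_uminus_if_pos[of y] by (auto simp: pos_def)

lemma pos_tie_cases:
  assumes "y \<in> V"
  obtains "pos y" | "pos (- y)" | "tie y"
proof -
  consider "C {0, y} = {0}" "y \<noteq> 0" | "C {0, y} = {y}" "y \<noteq> 0" | "C {0, y} = {0, y}"
    using C_pair_cases[OF assms] by (cases "y = 0") auto
  then show ?thesis
  proof cases
    case 1
    then have "C {0, - y} = {- y}" using C_uminus[OF assms] by (simp add: set_plus_def)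
    then show ?thesis using that(2) 1 by (simp add: pos_def)
  qed (use that in \<open>auto simp: pos_def tie_def\<close>)
qed

lemma pos_money:
  assumes "c > 0"
  shows "pos (money c)"
proof -
  have "v (money c) (money ` {0, c}) > v (money 0) (money ` {0, c})"
    using mono[unfolded money_monotone_def, rule_format, of "{0, c}" c 0] assms by blast
  then have "C {0, money c} = {money c}" by (auto simp: chosen_def)
  then show ?thesis using assms by (simp add: pos_def)
qed

text \<open>Provides a direction in which \<open>0\<close> alone is extreme in
  \<open>{0, s}\<close>, with \<open>s = 0\<close> allowed.\<close>

lemma exists_negative_functional:
  fixes s :: "('w, 'g) goods_bundle"
  shows "\<exists>f :: ('w, 'g) goods_bundle \<Rightarrow> real. (\<forall>x y. f (x + y) = f x + f y) \<and> (s \<noteq> 0 \<longrightarrow> f s < 0)"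
proof (cases "s = 0")
  case True
  then show ?thesis by (intro exI[of _ "\<lambda>_. 0"]) simp
next
  case False
  then obtain w i where wi: "s w $ i \<noteq> 0" using nonzero_coordinate by blast
  then have "s w $ i * s w $ i > 0" using not_real_square_gt_zero by blast
  then show ?thesis
    by (intro exI[of _ "\<lambda>x. - (s w $ i) * x w $ i"]) (simp add: algebra_simps)
qed

text \<open>In the sum \<open>G\<close> of the pairs for \<open>y\<close>, \<open>z\<close> and
  \<open>- (y + z)\<close>, the choices cancel to those from \<open>{0, y + z}\<close>. If
  \<open>y + z\<close> were not positive, \<open>0\<close> would be an exposed point of
  \<open>C G\<close>, although \<open>G\<close> contains both \<open>y\<close> and
  \<open>- y = z - (y + z)\<close>.\<close>

lemma pos_add:
  assumes y: "y \<in> V" "pos y" and z: "z \<in> V" "pos z"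
  shows "pos (y + z)"
proof (rule ccontr)
  assume np: "\<not> pos (y + z)"
  define s where "s = y + z"
  have s: "s \<in> V" using y z by (simp add: s_def bundles_closed)
  have cs: "choice_set M {0, y}" "choice_set M {0, z}" "choice_set M {0, - s}"
    using y z s choice_set_pair bundles_uminus by auto
  define G where "G = {0, y} + ({0, z} + {0, - s})"
  have G: "choice_set M G" unfolding G_def by (intro choice_set_plus cs)
  have "C G = {y} + ({z} + ({- s} + C {0, s}))"
    using C_plus3[OF cs] C_uminus[OF s] y(2) z(2) by (simp add: G_def pos_def)
  moreover have "{a} + S = (+) a ` S" for a :: "('w, 'g) goods_bundle" and S
    by (auto simp: set_plus_def)
  ultimately have CG: "C G = C {0, s}" by (simp add: image_image s_def algebra_simps)
  have CGs: "0 \<in> C G" "C G \<subseteq> {0, s}"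
    using C_pair_cases[OF s] np CG by (auto simp: pos_def s_def)
  obtain f :: "('w, 'g) goods_bundle \<Rightarrow> real"
    where f: "\<forall>x y. f (x + y) = f x + f y" "s \<noteq> 0 \<longrightarrow> f s < 0"
    using exists_negative_functional[of s] by blast
  have f_add: "f (x + y) = f x + f y" for x y using f(1) by blast
  have f0: "f 0 = 0" using f_add[of 0 0] by simp
  have face: "{0} = face f (C G)"
  proof (cases "C G = {0}")
    case True
    then show ?thesis by (auto simp: face_def)
  next
    case False
    then have "C G = {0, s}" "f s < 0" using CGs f(2) by auto
    then show ?thesis using f0 by (auto simp: face_def)
  qed
  have "y + (0 + 0) \<in> G" unfolding G_def by (intro set_plus_intro) auto
  moreover have "0 + (z + (- s)) \<in> G" unfolding G_def by (intro set_plus_intro) auto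
  moreover have "0 + (z + (- s)) = - y" by (simp add: s_def)
  moreover have "y \<noteq> 0" using y(2) by (simp add: pos_def)
  ultimately have "y \<in> G" "- y \<in> G" "y \<noteq> 0" by simp_all
  then show False by (rule chosen_zero_not_midpoint[OF G f_add face])
qed

text \<open>For sure money, monotonicity decides. Otherwise the sum of the pairs for
  \<open>y + money c\<close>, \<open>- y\<close> and \<open>- money c\<close> has \<open>0\<close>
  as an exposed point of its choices, although it contains both \<open>money c\<close> and
  \<open>- money c\<close>.\<close>

lemma tie_unique:
  assumes y: "y \<in> V" and c: "c > 0" and ty: "tie y" and tyc: "tie (y + money c)"
  shows False
proof (cases "\<exists>m. y = money m")
  case True
  then obtain m where m: "y = money m" by blast
  consider "m > 0" | "- m > 0" | "m = 0" by linarith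
  then show False
  proof cases
    case 1
    then show ?thesis using pos_money pos_not_tie ty m by blast
  next
    case 2
    then show ?thesis
      using pos_money[of "- m"] pos_not_tie tie_uminus[OF y ty] m by (simp add: sure_money_uminus)
  next
    case 3
    then show ?thesis using pos_money[OF c] pos_not_tie tyc m by simp
  qed
next
  case False
  define w0 where "w0 = (undefined :: 'w)"
  have "y - money (y w0 $ \<kappa>) \<noteq> 0" using False by auto
  then obtain w i where wi: "(y - money (y w0 $ \<kappa>)) w $ i \<noteq> 0" using nonzero_coordinate by blast
  \<comment> \<open>\<open>g\<close> vanishes on sure money but not at \<open>y\<close>, and
    \<open>h\<close> reads off money in one state; a combination can thus take prescribed values at
    \<open>y\<close> and \<open>money c\<close>.\<close>
  define g where "g = (\<lambda>x :: ('w, 'g) goods_bundle. (x - money (x w0 $ \<kappa>)) w $ i)"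
  define h where "h = (\<lambda>x :: ('w, 'g) goods_bundle. x w0 $ \<kappa>)"
  have g_add: "g (x + x') = g x + g x'" and h_add: "h (x + x') = h x + h x'" for x x'
    by (simp_all add: g_def h_def sure_money_add)
  have g_money: "g (money a) = 0" and h_money: "h (money a) = a" for a
    by (simp_all add: g_def h_def sure_money_def)
  have gy: "g y \<noteq> 0" using wi by (simp add: g_def)
  \<comment> \<open>This \<open>k\<close> gives \<open>f y = c / 2\<close>, halfway, so that
    \<open>f\<close> is negative at both \<open>y + money c\<close> and \<open>- y\<close>.\<close>
  define k where "k = (h y + c / 2) / g y"
  define f where "f = (\<lambda>x. k * g x - h x)"
  have f_add: "f (x + x') = f x + f x'" for x x'
    by (simp add: f_def g_add h_add algebra_simps)
  have f0: "f 0 = 0" using f_add[of 0 0] by simp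
  define a where "a = y + money c"
  define b where "b = - y"
  have fy: "f y = c / 2" using gy by (simp add: f_def k_def)
  have fm: "f (money c) = - c" by (simp add: f_def g_money h_money)
  have fa: "f a = - c / 2" using fy fm by (simp add: a_def f_add)
  have fb: "f b = - c / 2" using fy f_add[of y b] f0 by (simp add: b_def)
  have V: "a \<in> V" "b \<in> V" "- money c \<in> V" using y by (auto simp: a_def b_def bundles_closed)
  note cs = V[THEN choice_set_pair]
  define G where "G = {0, a} + ({0, b} + {0, - money c})"
  have G: "choice_set M G" unfolding G_def by (intro choice_set_plus cs)
  have "C {0, - money c} = {0}" using C_uminus_if_pos[OF _ pos_money[OF c]] by (simp add: bundles_closed)
  moreover have "C {0, a} = {0, a}" "C {0, b} = {0, b}"
    using tyc tie_uminus[OF y ty] by (auto simp: tie_def a_def b_def)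
  ultimately have "C G = {0, a} + ({0, b} + {0})"
    using C_plus3[OF cs] by (simp add: G_def)
  then have "C G = {0, a, b, a + b}" by (auto simp: set_plus_def)
  then have face: "{0} = face f (C G)" using fa fb f0 c f_add by (auto simp: face_def)
  have "a + (b + 0) \<in> G" unfolding G_def by (intro set_plus_intro) auto
  moreover have "0 + (0 + - money c) \<in> G" unfolding G_def by (intro set_plus_intro) auto
  moreover have "a + (b + 0) = money c" by (simp add: a_def b_def)
  ultimately have "money c \<in> G" "- money c \<in> G" "money c \<noteq> 0" using c by simp_all
  then show False by (rule chosen_zero_not_midpoint[OF G f_add face])
qed

section \<open>The price function and its additivity\<close>

definition price where "price x = (SOME m. tie (x - money m))"

lemma tie_price:
  assumes "x \<in> V"
  shows "tie (x - money (price x))"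
proof -
  have "\<exists>m. tie (x - money m)"
    using ex_indifference_price[OF assms zero_in_bundles] by (simp add: tie_def)
  then show ?thesis unfolding price_def by (rule someI_ex)
qed

lemma price_eqI:
  assumes "x \<in> V" "tie (x - money m)"
  shows "price x = m"
proof (rule ccontr)
  have shift: "x - money a = (x - money b) + money (b - a)" for a b
    by (simp add: sure_money_diff)
  have V: "x - money a \<in> V" for a using assms by (simp add: bundles_closed)
  assume "price x \<noteq> m"
  then consider "price x < m" | "m < price x" by linarith
  then show False
  proof cases
    case 1
    then show ?thesis
      using tie_unique[OF V, of "m - price x" m] assms(2) tie_price[OF assms(1)] shift by auto
  next
    case 2
    then show ?thesis
      using tie_unique[OF V, of "price x - m" "price x"] assms(2) tie_price[OF assms(1)] shift by auto
  qed
qed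

text \<open>If \<open>- (t + money c)\<close> were positive, adding \<open>money c\<close> would
  make \<open>- t\<close> positive, but it is a tie; a second tie contradicts
  \<open>tie_unique\<close>.\<close>

lemma pos_if_tie_add:
  assumes t: "t \<in> V" "tie t" and c: "c > 0"
  shows "pos (t + money c)"
proof -
  have V: "t + money c \<in> V" using t by (simp add: bundles_closed)
  then show ?thesis
  proof (cases rule: pos_tie_cases)
    case 2
    then have "pos (- (t + money c) + money c)"
      using pos_add[OF _ _ _ pos_money[OF c]] V by (simp only: bundles_closed)
    then have "pos (- t)" by simp
    then show ?thesis using tie_uminus[OF t] pos_not_tie by blast
  next
    case 3
    then show ?thesis using tie_unique t c by blast
  qed
qed

lemma pos_if_price_pos:
  assumes "x \<in> V" "price x > 0"
  shows "pos x"
  using pos_if_tie_add[OF _ tie_price[OF assms(1)] assms(2)] assms by (simp add: bundles_closed)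

lemma price_minus_money: "x \<in> V \<Longrightarrow> price (x - money c) = price x - c"
  using price_eqI[of "x - money c" "price x - c"] tie_price[of x]
  by (simp add: bundles_closed sure_money_diff)

lemma price_uminus: "x \<in> V \<Longrightarrow> price (- x) = - price x"
  using price_eqI[of "- x" "- price x"] tie_uminus[OF _ tie_price[of x]]
  by (simp add: bundles_closed sure_money_uminus)

text \<open>Otherwise \<open>x + y\<close> has a price \<open>q > 0\<close>. Giving
  \<open>- x\<close> and \<open>- y\<close> a bonus of \<open>q / 4\<close> each makes both
  positive, and their sum is the negative of \<open>x + y - money (q / 2)\<close>, which is positive
  too.\<close>

lemma not_pos_tie_add_tie:
  assumes x: "x \<in> V" "tie x" and y: "y \<in> V" "tie y"
  shows "\<not> pos (x + y)"
proof
  assume pos: "pos (x + y)"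
  have V: "x + y \<in> V" using x y by (simp add: bundles_closed)
  define q where "q = price (x + y)"
  have "q > 0"
  proof (rule ccontr)
    assume "\<not> q > 0"
    then consider "price (- (x + y)) > 0" | "price (x + y) = 0"
      using price_uminus[OF V] by (fastforce simp: q_def)
    then show False
    proof cases
      case 1
      then show ?thesis using pos_if_price_pos pos_asym V pos bundles_uminus by blast
    next
      case 2
      then show ?thesis using tie_price[OF V] pos pos_not_tie by simp
    qed
  qed
  have P: "pos (- x + money (q / 4))" "pos (- y + money (q / 4))"
    using pos_if_tie_add[OF bundles_uminus tie_uminus] x y \<open>q > 0\<close> by simp_all
  have "pos ((- x + money (q / 4)) + (- y + money (q / 4)))"
    by (rule pos_add[OF _ P(1) _ P(2)]) (use x y in \<open>auto intro!: bundles_closed\<close>)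
  moreover have "money (q / 2) = money (q / 4) + money (q / 4)"
    by (simp flip: sure_money_add)
  moreover have "(- x + a) + (- y + a) = - (x + y - (a + a))" for a
    by (simp add: algebra_simps)
  moreover have "pos (x + y - money (q / 2))"
    using V \<open>q > 0\<close> by (intro pos_if_price_pos) (auto simp: price_minus_money q_def bundles_closed)
  ultimately have "pos (- (x + y - money (q / 2)))" "pos (x + y - money (q / 2))" by metis+
  then show False using pos_asym V by (metis bundles_diff sure_money_in_bundles)
qed

text \<open>After subtracting the prices, the sum of two ties is neither positive nor the negative
  of something positive, hence a tie.\<close>

lemma price_add:
  assumes "x \<in> V" "y \<in> V"
  shows "price (x + y) = price x + price y"
proof -
  let ?x = "x - money (price x)" and ?y = "y - money (price y)"
  have V: "?x \<in> V" "?y \<in> V" "?x + ?y \<in> V" using assms by (auto intro!: bundles_closed)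
  have t: "tie ?x" "tie ?y" using assms tie_price by auto
  have "\<not> pos (?x + ?y)" using not_pos_tie_add_tie V t by blast
  moreover have "\<not> pos (- (?x + ?y))"
    using not_pos_tie_add_tie[OF bundles_uminus tie_uminus bundles_uminus tie_uminus, of ?x ?y] V t
    by (simp add: algebra_simps)
  ultimately have "tie (?x + ?y)" using pos_tie_cases[OF V(3)] by blast
  moreover have "?x + ?y = (x + y) - money (price x + price y)" by (simp add: sure_money_add)
  ultimately show ?thesis using price_eqI assms by (simp add: bundles_closed)
qed

lemma price_diff: "x \<in> V \<Longrightarrow> y \<in> V \<Longrightarrow> price (x - y) = price x - price y"
  using price_add[of x "- y"] by (simp add: price_uminus bundles_closed)

section \<open>Chosen options maximize the price\<close>

text \<open>\<open>L\<close> is the sum of the pairs \<open>{0, - t}\<close>. Adding it to a choice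
  set enlarges the set without changing what is chosen.\<close>

lemma exists_null_choice_set:
  assumes "finite F" "F \<subseteq> V" "\<And>t. t \<in> F \<Longrightarrow> pos t"
  shows "\<exists>L. choice_set M L \<and> 0 \<in> L \<and> (\<forall>t\<in>F. - t \<in> L) \<and> C L = {0}"
  using assms
proof (induction F)
  case empty
  show ?case using C_singleton[of 0] choice_set_singleton[OF zero_in_bundles] by blast
next
  case (insert t F)
  then have "F \<subseteq> V" "\<And>t. t \<in> F \<Longrightarrow> pos t" by simp_all
  from insert.IH[OF this] obtain L
    where L: "choice_set M L \<and> 0 \<in> L \<and> (\<forall>t\<in>F. - t \<in> L) \<and> C L = {0}" ..
  have t: "choice_set M {0, - t}" "C {0, - t} = {0}"
    using choice_set_pair[OF bundles_uminus, of t] C_uminus_if_pos[of t] insert.prems by simp_all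
  have LL: "0 + a \<in> {0, - t} + L" if "a \<in> L" for a using that by (intro set_plus_intro) simp_all
  have Lt: "- t + 0 \<in> {0, - t} + L" using L by (intro set_plus_intro) simp_all
  show ?case
  proof (intro exI conjI ballI)
    show "choice_set M ({0, - t} + L)" using choice_set_plus[OF t(1)] L by simp
    show "0 \<in> {0, - t} + L" using LL[of 0] L by simp
    show "- s \<in> {0, - t} + L" if "s \<in> insert t F" for s
      using that LL[of "- s"] Lt L by (cases "s = t") simp_all
    have "C ({0, - t} + L) = {0} + {0}" using C_plus[OF t(1)] t(2) L by simp
    then show "C ({0, - t} + L) = {0}" by (simp add: set_plus_def)
  qed
qed

lemma chosen_price_max:
  assumes K: "choice_set M K" and w: "w \<in> C K" and y: "y \<in> K"
  shows "price y \<le> price w"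
proof (rule ccontr)
  assume less: "\<not> price y \<le> price w"
  \<comment> \<open>The sign makes \<open>R\<close> the cheapest chosen options, so
    \<open>price w\<close> bounds all their prices from above.\<close>
  define f where "f = (\<lambda>x. - price x)"
  define R where "R = face f (C K)"
  have KV: "K \<subseteq> V" using K by (simp add: choice_set_def)
  have RK: "R \<subseteq> K" using face_subset chosen_subset unfolding R_def by (rule subset_trans)
  have Rw: "price r \<le> price w" if "r \<in> R" for r
    using that w by (auto simp: R_def face_def f_def)
  have Req: "price r = price r'" if "r \<in> R" "r' \<in> R" for r r'
    using that by (fastforce simp: R_def face_def f_def)
  have pos: "pos (y - r)" if "r \<in> R" for r
    using Rw[OF that] that RK KV y less
    by (intro pos_if_price_pos) (auto simp: price_diff subset_eq intro!: bundles_closed)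
  have F: "finite ((\<lambda>r. y - r) ` R)" "(\<lambda>r. y - r) ` R \<subseteq> V"
    using RK KV y K by (auto simp: choice_set_def intro: finite_subset intro!: bundles_closed)
  have "pos t" if "t \<in> (\<lambda>r. y - r) ` R" for t using that pos by blast
  from exists_null_choice_set[OF F this]
  obtain L where L: "choice_set M L" "0 \<in> L" "\<forall>r\<in>R. - (y - r) \<in> L" "C L = {0}"
    by auto
  define G where "G = K + L"
  have G: "choice_set M G" unfolding G_def by (intro choice_set_plus K L)
  have "C G = C K" using C_plus[OF K L(1)] L(4) by (simp add: G_def set_plus_def)
  then have face: "R = face f (C G)" by (simp add: R_def)
  show False
  proof (rule chosen_face_not_redundant[OF G _ face])
    fix x z assume "x \<in> V" "z \<in> V"
    then show "f (x + z) = f x + f z" by (simp add: f_def price_add)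
  next
    fix r s assume rs: "r \<in> R" "s \<in> R"
    have V: "r \<in> V" "s \<in> V" "y \<in> V" using rs RK KV y by auto
    have "r + - (y - s) \<in> G" unfolding G_def using rs RK L by (intro set_plus_intro) auto
    moreover have "y + 0 \<in> G" unfolding G_def using y L by (intro set_plus_intro)
    \<comment> \<open>The two replacements lie strictly below and above the common price of
      \<open>R\<close>, so neither belongs to \<open>R\<close>.\<close>
    moreover have "price (r + - (y - s)) < price r"
      using V Rw[OF rs(2)] less by (simp add: price_diff price_add bundles_closed)
    moreover have "price (y + 0) > price r" using Rw[OF rs(1)] less by simp
    ultimately have "r + - (y - s) \<in> G - R" "y + 0 \<in> G - R"
      using Req[OF _ rs(1)] by (metis DiffI less_irrefl)+
    moreover have "r + s = (r + - (y - s)) + (y + 0)" by simp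
    ultimately show "\<exists>a\<in>G - R. \<exists>b\<in>G - R. r + s = a + b"
      by - (rule bexI, rule bexI, assumption+)
  qed
qed

text \<open>By additivity, \<open>price X\<close> separates the two amounts:
  \<open>m \<le> price X \<le> m'\<close>.\<close>

lemma consistent_prices: consistent_prices
  unfolding consistent_prices_def
proof (intro ballI allI impI)
  fix X Y Y' m m' S S'
  assume V: "X \<in> V" "Y \<in> V" "Y' \<in> V" and S: "choice_set M S" "choice_set M S'"
    and buy: "Y \<in> S" "Y + X - money m \<in> C S" and sell: "Y' \<in> C S'" "Y' + X - money m' \<in> S'"
  have "price Y \<le> price (Y + X - money m)" using chosen_price_max S buy by blast
  moreover have "price (Y' + X - money m') \<le> price Y'" using chosen_price_max S sell by blast
  ultimately show "m \<le> m'" using V by (simp add: price_minus_money price_add bundles_closed)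
qed

end

theorem proposition3:
  fixes M :: "'w measure" and \<kappa> :: "'g::finite" and v :: "('w, 'g) val"
  assumes "prob_space M" and "space M = UNIV"
    and "continuous_value M v"
    and "money_monotone \<kappa> v"
    and "money_nonsatiated M \<kappa> v"
  shows "bracketing_identified M v \<longleftrightarrow> price_differential M \<kappa> v > 0"
proof -
  interpret value_fun M \<kappa> v using assms(3-5) by unfold_locales
  have "consistent_prices" if "\<not> bracketing_identified M v"
  proof -
    interpret additive_choice M \<kappa> v using that by unfold_locales (simp add: not_identified_iff)
    show ?thesis by (rule consistent_prices)
  qed
  then show ?thesis
    using not_identified_if_consistent_prices price_differential_le_0_iff by (metis not_le)
qed

end
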